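(* Let $\{x_t\}_{t\in[0,1]}$ be a continuous-time Markov chain on the finite state space $\mathcal X^d$ with time-dependent rate matrix $\mathcal R_t$, where $\mathcal R_t(x,y)$ is the transition rate from $y$ to $x$, and marginal probabilities $q_t>0$. Then: (1) the adjoint of the spatial generator acts on a function $\phi:\mathcal X^d\to\mathbb R$ by $(\mathscr L_t)^*\phi(x)=\sum_{y\in\mathcal X^d}\mathcal R_t(x,y)\phi(y)$; (2) the marginals satisfy the master equation $\partial_tq_t(x)=\sum_{y\in\mathcal X^d}\mathcal R_t(x,y)q_t(y)$; (3) the reverse generator $\hat{\mathscr L}_s\phi:=\frac1{q_{1-s}}\bigl((\mathscr L_{1-s})^*[q_{1-s}\phi]-\phi\,(\mathscr L_{1-s})^*q_{1-s}\bigr)$ is $$\hat{\mathscr L}_s\phi(x)=\sum_{y\in\mathcal X^d}\mathcal R_{1-s}(x,y)\,\frac{q_{1-s}(y)}{q_{1-s}(x)}\,\bigl[\phi(y)-\phi(x)\bigr].$$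
   Context: $\mathcal X=\{1,\dots,K\}$. The rate matrix satisfies $\mathcal R_t(x,y)\ge0$ for $x\ne y$ and $\mathcal R_t(x,x)=-\sum_{y\ne x}\mathcal R_t(y,x)$ (columns sum to zero), is continuous in $t$, and determines the chain by $\Pr(x_{t+h}=x\mid x_t=y)=\delta_{x,y}+\mathcal R_t(x,y)h+o(h)$ as $h\to0^+$. The spatial generator is $\mathscr L_t\phi(x)=\lim_{h\to0^+}\frac{\mathbb E[\phi(x_{t+h})\mid x_t=x]-\phi(x)}{h}$ and $(\mathscr L_t)^*$ is its adjoint for the inner product $\langle f,g\rangle=\sum_xf(x)g(x)$. $q_t(x)=\Pr(x_t=x)$.
   Formalization: The chain is also assumed stochastically continuous on [0,1] (no jumps at fixed times), without which the master equation can fail; (1) is stated for t<1 and (3) for s>0, since the forward limit defining the generator does not exist at time 1. *)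

theory Defs
  imports "HOL-Probability.Probability" "HOL-Library.Landau_Symbols"
begin

(* A chain on the time interval [0,1]; the values of X and R outside [0,1] are irrelevant.
   R t x y is the rate of jumping from y to x, so columns sum to zero.
   Transition probabilities are only constrained where the conditioning event has positive
   probability, since cond_prob is 0 otherwise.
   Stochastic continuity is part of the notion of a chain determined by its rates: the one-sided
   condition "infinitesimal" still admits a chain that jumps with positive probability at a fixed
   time t0, i.e. whose marginals are discontinuous from the left at t0. Together with the other
   axioms, stochastic continuity amounts to the o(h) in "infinitesimal" being uniform in t. *)
locale ctmc = prob_space M
  for M :: "'w measure" +
  fixes X :: "real \<Rightarrow> 'w \<Rightarrow> 's::finite"
    and R :: "real \<Rightarrow> 's \<Rightarrow> 's \<Rightarrow> real"
  assumes random_variable: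
      "\<And>t. t \<in> {0..1} \<Longrightarrow> random_variable (count_space UNIV) (X t)"
    and markov:
      "\<And>J s t x y z. \<lbrakk>0 \<le> s; s \<le> t; t \<le> 1; finite J; J \<subseteq> {0..<s};
          \<P>(\<omega> in M. X s \<omega> = y \<and> (\<forall>u\<in>J. X u \<omega> = z u)) > 0\<rbrakk>
        \<Longrightarrow> \<P>(\<omega> in M. X t \<omega> = x \<bar> X s \<omega> = y \<and> (\<forall>u\<in>J. X u \<omega> = z u))
          = \<P>(\<omega> in M. X t \<omega> = x \<bar> X s \<omega> = y)"
    and stochastically_continuous:
      "\<And>t. t \<in> {0..1} \<Longrightarrow>
        ((\<lambda>s. \<P>(\<omega> in M. X s \<omega> \<noteq> X t \<omega>)) \<longlongrightarrow> 0) (at t within {0..1})"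
    and rate_nonneg:
      "\<And>t x y. \<lbrakk>t \<in> {0..1}; x \<noteq> y\<rbrakk> \<Longrightarrow> R t x y \<ge> 0"
    and rate_diag:
      "\<And>t x. t \<in> {0..1} \<Longrightarrow> R t x x = - (\<Sum>y\<in>UNIV - {x}. R t y x)"
    and rate_continuous:
      "\<And>x y. continuous_on {0..1} (\<lambda>t. R t x y)"
    and infinitesimal:
      "\<And>t x y. \<lbrakk>t \<in> {0..<1}; \<P>(\<omega> in M. X t \<omega> = y) > 0\<rbrakk> \<Longrightarrow>
        (\<lambda>h. \<P>(\<omega> in M. X (t + h) \<omega> = x \<bar> X t \<omega> = y) - ((if x = y then 1 else 0) + R t x y * h))
          \<in> o[at_right 0](\<lambda>h. h)"

(* Real functions on the finite state space 's are elements of real ^ 's, whose inner product is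
   (\<Sum>x. f x * g x); the library's adjoint is then the adjoint meant here. *)

definition marginal :: "'w measure \<Rightarrow> (real \<Rightarrow> 'w \<Rightarrow> 's::finite) \<Rightarrow> real \<Rightarrow> real ^ 's" where
  "marginal M X t = (\<chi> x. \<P>(\<omega> in M. X t \<omega> = x))"

(* The conditional expectation given the event X t = x is the expectation under the
   conditioned probability measure. As X lives on [0,1], the limit is meaningful for 0 <= t < 1. *)
definition generator ::
  "'w measure \<Rightarrow> (real \<Rightarrow> 'w \<Rightarrow> 's::finite) \<Rightarrow> real \<Rightarrow> real ^ 's \<Rightarrow> real ^ 's" where
  "generator M X t \<phi> = (\<chi> x. Lim (at_right 0) (\<lambda>h.
     ((\<integral>\<omega>. \<phi> $ X (t + h) \<omega> \<partial>uniform_measure M {\<omega> \<in> space M. X t \<omega> = x}) - \<phi> $ x) / h))"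

definition reverse_generator ::
  "'w measure \<Rightarrow> (real \<Rightarrow> 'w \<Rightarrow> 's::finite) \<Rightarrow> real \<Rightarrow> real ^ 's \<Rightarrow> real ^ 's" where
  "reverse_generator M X s \<phi> =
     (let q = marginal M X (1 - s); L_adj = adjoint (generator M X (1 - s))
      in \<chi> x. 1 / q $ x * (L_adj (\<chi> y. q $ y * \<phi> $ y) $ x - \<phi> $ x * L_adj q $ x))"

end

theory Submission
  imports Defs
begin

text \<open>Conditioning on the present state turns the infinitesimal description of the chain into
  one-sided (right) derivatives, both of conditional expectations and of the marginals. The
  right derivative of a marginal is the right-hand side of the master equation, which is
  continuous in time because stochastic continuity makes the marginals continuous. A continuous
  function with a continuous right derivative is an antiderivative of it, so the master equation
  holds with two-sided derivatives.\<close>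

text \<open>With only right derivatives at hand, the mean value theorem is replaced by a last-time
  argument: for every slope \<open>e > 0\<close>, the bound \<open>e * (t - a)\<close> on the
  increment cannot stop holding at any time before the right endpoint.\<close>

lemma right_derivative_zero_imp_constant:
  fixes f :: "real \<Rightarrow> real"
  assumes cont: "continuous_on {a..b} f"
    and deriv: "\<And>t. t \<in> {a..<b} \<Longrightarrow> (f has_real_derivative 0) (at_right t)"
    and t: "t \<in> {a..b}"
  shows "f t = f a"
proof -
  have bound: "\<bar>f t - f a\<bar> \<le> e * (t - a)" if e: "e > 0" for e
  proof (rule ccontr)
    assume neg: "\<not> ?thesis"
    \<comment> \<open>\<open>S\<close> contains \<open>a\<close> and is closed by continuity, so it
      has a largest element \<open>c\<close>, which differs from \<open>t\<close> if the bound fails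
      at \<open>t\<close>. The contradiction will be an element of \<open>S\<close> beyond
      \<open>c\<close>.\<close>
    define S where "S = {s \<in> {a..t}. \<bar>f s - f a\<bar> - e * (s - a) \<le> 0}"
    have "continuous_on {a..t} (\<lambda>s. \<bar>f s - f a\<bar> - e * (s - a))"
      using t by (intro continuous_intros continuous_on_subset[OF cont]) auto
    then have "closed S"
      unfolding S_def by (intro continuous_on_closed_Collect_le continuous_on_const) auto
    moreover have "a \<in> S" using t by (auto simp: S_def)
    moreover have bdd: "bdd_above S" by (rule bdd_aboveI[of _ t]) (auto simp: S_def)
    ultimately have c: "Sup S \<in> S" by (intro closed_contains_Sup) auto
    define c where "c = Sup S"
    have cS: "c \<in> S" and c_max: "\<And>s. s \<in> S \<Longrightarrow> s \<le> c"
      using c bdd by (auto simp: c_def intro: cSup_upper)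
    have "c \<noteq> t" using cS neg by (auto simp: S_def)
    then have ct: "a \<le> c" "c < t" using cS by (auto simp: S_def)
    \<comment> \<open>Just to the right of \<open>c\<close> the difference quotients are below
      \<open>e\<close> in absolute value, so the increment after \<open>c\<close> adds at most
      \<open>e * (s - c)\<close> to the bound valid at \<open>c\<close>.\<close>
    have "((\<lambda>s. (f s - f c) / (s - c)) \<longlongrightarrow> 0) (at_right c)"
      using deriv[of c] ct t by (auto simp: has_field_derivative_iff)
    then have "eventually (\<lambda>s. \<bar>(f s - f c) / (s - c)\<bar> < e) (at_right c)"
      using e by (auto simp: tendsto_iff)
    then have "eventually (\<lambda>s. \<bar>(f s - f c) / (s - c)\<bar> < e \<and> s \<in> {c<..<t}) (at_right c)"
      using eventually_at_right_real[OF ct(2)] by (rule eventually_conj)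
    then obtain s where s: "\<bar>(f s - f c) / (s - c)\<bar> < e" "c < s" "s < t"
      using eventually_happens'[OF trivial_limit_at_right_real] by fastforce
    then have "\<bar>f s - f c\<bar> < e * (s - c)"
      by (simp add: abs_divide divide_less_eq)
    moreover have "\<bar>f c - f a\<bar> \<le> e * (c - a)" using cS by (auto simp: S_def)
    ultimately have "\<bar>f s - f a\<bar> \<le> e * (s - a)" by (auto simp: algebra_simps abs_if split: if_splits)
    then have "s \<in> S" using s ct by (auto simp: S_def)
    then show False using c_max s by force
  qed
  have "\<bar>f t - f a\<bar> \<le> 0 + e" if "e > 0" for e
  proof -
    \<comment> \<open>The summand 1 keeps the slope well defined and positive when
      \<open>t = a\<close>, while the total error stays at most \<open>e\<close>.\<close>
    have "\<bar>f t - f a\<bar> \<le> e / (t - a + 1) * (t - a)" using bound[of "e / (t - a + 1)"] that t by simp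
    also have "\<dots> \<le> e" using that t by (simp add: field_simps)
    finally show ?thesis by simp
  qed
  then have "\<bar>f t - f a\<bar> \<le> 0" by (rule field_le_epsilon)
  then show ?thesis by simp
qed

text \<open>The integral \<open>G\<close> of the continuous \<open>g\<close> is differentiable from
  both sides, and \<open>f - G\<close> has right derivative 0. Hence \<open>f\<close> is
  \<open>G\<close> plus a constant and inherits its derivative.\<close>

lemma continuous_right_derivative_imp_derivative:
  fixes f g :: "real \<Rightarrow> real"
  assumes f: "continuous_on {a..b} f" and g: "continuous_on {a..b} g"
    and deriv: "\<And>t. t \<in> {a..<b} \<Longrightarrow> (f has_real_derivative g t) (at_right t)"
    and t: "t \<in> {a..b}"
  shows "(f has_real_derivative g t) (at t within {a..b})"
proof -
  define G where "G = (\<lambda>t. integral {a..t} g)"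
  have G: "(G has_real_derivative g s) (at s within {a..b})" if "s \<in> {a..b}" for s
    unfolding G_def using integral_has_real_derivative[OF g that] .
  have const: "f s - G s = f a - G a" if "s \<in> {a..b}" for s
  proof (rule right_derivative_zero_imp_constant[OF _ _ that])
    show "continuous_on {a..b} (\<lambda>s. f s - G s)"
      using G by (intro continuous_on_diff f DERIV_continuous_on) auto
    fix u assume u: "u \<in> {a..<b}"
    have "(G has_real_derivative g u) (at u within {u<..<b})"
      using u by (intro DERIV_subset[OF G]) auto
    moreover have "at u within {u<..<b} = at_right u"
      using u by (intro at_within_nhd[of u "{..<b}"]) auto
    ultimately show "((\<lambda>s. f s - G s) has_real_derivative 0) (at_right u)"
      using DERIV_diff[OF deriv[OF u], of G "g u"] by simp
  qed
  have eq: "G s + (f a - G a) = f s" if "s \<in> {a..b}" for s using const[OF that] by linarith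
  have "((\<lambda>s. G s + (f a - G a)) has_real_derivative g t) (at t within {a..b})"
    using DERIV_add[OF G[OF t] DERIV_const] by simp
  then show ?thesis
    by (rule has_field_derivative_transform_within[OF _ zero_less_one t]) (rule eq)
qed

context ctmc
begin

lemma event_eq [measurable]: "t \<in> {0..1} \<Longrightarrow> {\<omega> \<in> space M. X t \<omega> = x} \<in> events"
  using measurable_sets[OF random_variable, of t "{x}"]
  by (simp add: vimage_def Int_def conj_commute)

lemma event_eq_eq:
  assumes "s \<in> {0..1}" "t \<in> {0..1}"
  shows "{\<omega> \<in> space M. X s \<omega> = x \<and> X t \<omega> = y} \<in> events"
  using assms by (intro sets.sets_Collect_conj event_eq)

text \<open>This is \<open>infinitesimal\<close> divided by \<open>h\<close>. The generator and the
  right derivative of a marginal are both limits of finite weighted sums of such quotients.\<close>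

lemma transition_quotient_tendsto:
  assumes "t \<in> {0..<1}" "\<P>(\<omega> in M. X t \<omega> = y) > 0"
  shows "((\<lambda>h. (\<P>(\<omega> in M. X (t + h) \<omega> = x \<bar> X t \<omega> = y) - (if x = y then 1 else 0)) / h)
          \<longlongrightarrow> R t x y) (at_right 0)"
proof -
  let ?p = "\<lambda>h. \<P>(\<omega> in M. X (t + h) \<omega> = x \<bar> X t \<omega> = y)"
  let ?d = "if x = y then 1 else 0 :: real"
  have "((\<lambda>h. (?p h - (?d + R t x y * h)) / h + R t x y) \<longlongrightarrow> 0 + R t x y) (at_right 0)"
    using smalloD_tendsto[OF infinitesimal[OF assms]] by (intro tendsto_add tendsto_const)
  moreover have "eventually (\<lambda>h. (?p h - (?d + R t x y * h)) / h + R t x y = (?p h - ?d) / h)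
      (at_right 0)"
    using eventually_at_right_less[of "0::real"] by eventually_elim (simp add: field_simps)
  ultimately show ?thesis by (simp add: tendsto_cong)
qed

text \<open>On a finite state space, \<open>\<phi> (X s \<omega>)\<close> is a finite combination of
  indicators of the events \<open>X s = y\<close>, and the conditioned measure of such an event is a
  conditional probability.\<close>

lemma conditional_expectation_eq_sum:
  assumes s: "s \<in> {0..1}" and t: "t \<in> {0..1}" and pos: "\<P>(\<omega> in M. X t \<omega> = x) > 0"
  shows "(\<integral>\<omega>. \<phi> (X s \<omega>) \<partial>uniform_measure M {\<omega> \<in> space M. X t \<omega> = x})
    = (\<Sum>y\<in>UNIV. \<phi> y * \<P>(\<omega> in M. X s \<omega> = y \<bar> X t \<omega> = x))"
proof -
  let ?A = "{\<omega> \<in> space M. X t \<omega> = x}"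
  let ?B = "\<lambda>y. {\<omega> \<in> space M. X s \<omega> = y}"
  let ?U = "uniform_measure M ?A"
  have em: "emeasure M ?A \<noteq> 0" using pos by (auto simp: measure_def)
  interpret U: prob_space ?U
    using em by (intro prob_space_uniform_measure) (auto simp: emeasure_eq_measure)
  have "(\<integral>\<omega>. \<phi> (X s \<omega>) \<partial>?U) = (\<integral>\<omega>. (\<Sum>y\<in>UNIV. \<phi> y * indicator (?B y) \<omega>) \<partial>?U)"
    by (intro Bochner_Integration.integral_cong)
      (auto simp: indicator_def if_distrib cong: if_cong)
  also have "\<dots> = (\<Sum>y\<in>UNIV. \<phi> y * measure ?U (?B y))"
  proof (subst Bochner_Integration.integral_sum)
    show "integrable ?U (\<lambda>\<omega>. \<phi> y * indicator (?B y) \<omega>)" for y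
      using event_eq[OF s, of y]
      by (intro integrable_mult_right integrable_real_indicator)
        (auto simp: U.emeasure_eq_measure)
    show "(\<Sum>y\<in>UNIV. \<integral>\<omega>. \<phi> y * indicator (?B y) \<omega> \<partial>?U) = (\<Sum>y\<in>UNIV. \<phi> y * measure ?U (?B y))"
      using event_eq[OF s, THEN sets.sets_into_space] by (simp add: Int_absorb2)
  qed
  also have "\<dots> = (\<Sum>y\<in>UNIV. \<phi> y * \<P>(\<omega> in M. X s \<omega> = y \<bar> X t \<omega> = x))"
  proof (intro sum.cong refl arg_cong2[where f = "(*)"])
    fix y
    have "?A \<inter> ?B y = {\<omega> \<in> space M. X s \<omega> = y \<and> X t \<omega> = x}" by auto
    then show "measure ?U (?B y) = \<P>(\<omega> in M. X s \<omega> = y \<bar> X t \<omega> = x)"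
      using em event_eq[OF s, of y]
      by (subst measure_uniform_measure) (auto simp: cond_prob_def emeasure_eq_measure)
  qed
  finally show ?thesis .
qed

lemma generator_eq:
  assumes t: "t \<in> {0..<1}" and pos: "\<P>(\<omega> in M. X t \<omega> = x) > 0"
  shows "generator M X t \<phi> $ x = (\<Sum>y\<in>UNIV. R t y x * \<phi> $ y)"
proof -
  let ?p = "\<lambda>h y. \<P>(\<omega> in M. X (t + h) \<omega> = y \<bar> X t \<omega> = x)"
  let ?d = "\<lambda>y. if y = x then 1 else 0 :: real"
  have "((\<lambda>h. \<Sum>y\<in>UNIV. (?p h y - ?d y) / h * \<phi> $ y) \<longlongrightarrow> (\<Sum>y\<in>UNIV. R t y x * \<phi> $ y)) (at_right 0)"
    by (intro tendsto_sum tendsto_mult tendsto_const transition_quotient_tendsto assms)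
  moreover have "eventually (\<lambda>h. (\<Sum>y\<in>UNIV. (?p h y - ?d y) / h * \<phi> $ y) =
      ((\<integral>\<omega>. \<phi> $ X (t + h) \<omega> \<partial>uniform_measure M {\<omega> \<in> space M. X t \<omega> = x}) - \<phi> $ x) / h)
      (at_right 0)"
  proof (rule eventually_mono[OF eventually_at_right_real[of 0 "1 - t"]])
    show "0 < 1 - t" using t by simp
    \<comment> \<open>The restriction \<open>h < 1 - t\<close> keeps \<open>t + h\<close> inside the
      time interval, where \<open>X (t + h)\<close> is measurable.\<close>
    fix h assume h: "h \<in> {0<..<1 - t}"
    \<comment> \<open>Writing \<open>\<phi> $ x\<close> as a sum against the Kronecker delta lets it
      be absorbed termwise into the transition quotients.\<close>
    have "(\<integral>\<omega>. \<phi> $ X (t + h) \<omega> \<partial>uniform_measure M {\<omega> \<in> space M. X t \<omega> = x}) - \<phi> $ x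
        = (\<Sum>y\<in>UNIV. \<phi> $ y * ?p h y) - (\<Sum>y\<in>UNIV. \<phi> $ y * ?d y)"
      using t h pos conditional_expectation_eq_sum[of "t + h" t x "\<lambda>y. \<phi> $ y"]
      by (simp add: if_distrib cong: if_cong)
    also have "\<dots> = (\<Sum>y\<in>UNIV. (?p h y - ?d y) * \<phi> $ y)"
      by (simp only: sum_subtractf left_diff_distrib mult.commute[of "\<phi> $ _"])
    finally show "(\<Sum>y\<in>UNIV. (?p h y - ?d y) / h * \<phi> $ y) =
      ((\<integral>\<omega>. \<phi> $ X (t + h) \<omega> \<partial>uniform_measure M {\<omega> \<in> space M. X t \<omega> = x}) - \<phi> $ x) / h"
      by (simp add: sum_divide_distrib)
  qed
  ultimately have "((\<lambda>h. ((\<integral>\<omega>. \<phi> $ X (t + h) \<omega> \<partial>uniform_measure M {\<omega> \<in> space M. X t \<omega> = x}) - \<phi> $ x) / h)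
      \<longlongrightarrow> (\<Sum>y\<in>UNIV. R t y x * \<phi> $ y)) (at_right 0)"
    by (rule Lim_transform_eventually)
  \<comment> \<open>\<open>Lim\<close> is a description operator, so its value comes from the
    convergence just proved and uniqueness of limits along the nontrivial filter
    \<open>at_right 0\<close>.\<close>
  then show ?thesis
    unfolding generator_def vec_lambda_beta by (intro tendsto_Lim) auto
qed

text \<open>The generator sums over target states, so it acts by the transpose of
  \<open>R t\<close>, and its adjoint acts by \<open>R t\<close> itself. Exhibiting that map
  suffices, since adjoints are unique. Positivity at every state makes \<open>generator_eq\<close>
  available in each coordinate.\<close>

lemma adjoint_generator_eq:
  assumes t: "t \<in> {0..<1}" and pos: "\<And>x. \<P>(\<omega> in M. X t \<omega> = x) > 0"
  shows "adjoint (generator M X t) \<phi> = (\<chi> x. \<Sum>y\<in>UNIV. R t x y * \<phi> $ y)"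
proof -
  have "adjoint (generator M X t) = (\<lambda>\<phi>. \<chi> x. \<Sum>y\<in>UNIV. R t x y * \<phi> $ y)"
  proof (intro adjoint_unique allI)
    fix f g :: "real ^ 's"
    have "generator M X t f \<bullet> g = (\<Sum>x\<in>UNIV. \<Sum>y\<in>UNIV. R t y x * f $ y * g $ x)"
      by (simp add: inner_vec_def generator_eq[OF t pos] sum_distrib_right)
    also have "\<dots> = (\<Sum>y\<in>UNIV. \<Sum>x\<in>UNIV. R t y x * f $ y * g $ x)"
      by (rule sum.swap)
    also have "\<dots> = f \<bullet> (\<chi> x. \<Sum>y\<in>UNIV. R t x y * g $ y)"
      by (simp add: inner_vec_def sum_distrib_left mult_ac)
    finally show "generator M X t f \<bullet> g = f \<bullet> (\<chi> x. \<Sum>y\<in>UNIV. R t x y * g $ y)" .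
  qed
  then show ?thesis by simp
qed

lemma reverse_generator_eq:
  assumes s: "s \<in> {0<..1}" and pos: "\<And>x. \<P>(\<omega> in M. X (1 - s) \<omega> = x) > 0"
  shows "reverse_generator M X s \<phi> $ x =
    (\<Sum>y\<in>UNIV. R (1 - s) x y * (marginal M X (1 - s) $ y / marginal M X (1 - s) $ x)
       * (\<phi> $ y - \<phi> $ x))"
proof -
  \<comment> \<open>The value \<open>s = 0\<close> is excluded because the generator at time 1 would
    look beyond the time interval.\<close>
  have t: "1 - s \<in> {0..<1}" using s by auto
  show ?thesis
    unfolding reverse_generator_def Let_def adjoint_generator_eq[OF t pos] vec_lambda_beta
    by (simp add: left_diff_distrib right_diff_distrib diff_divide_distrib sum_subtractf
        sum_distrib_left sum_divide_distrib mult_ac)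
qed

lemma marginal_continuous: "continuous_on {0..1} (\<lambda>t. marginal M X t $ x)"
  unfolding continuous_on
proof
  fix t :: real assume t: "t \<in> {0..1}"
  \<comment> \<open>The events \<open>X s = x\<close> and \<open>X t = x\<close> differ only where
    \<open>X s\<close> and \<open>X t\<close> disagree, so stochastic continuity controls the
    marginals.\<close>
  have le: "\<bar>marginal M X s $ x - marginal M X t $ x\<bar> \<le> \<P>(\<omega> in M. X s \<omega> \<noteq> X t \<omega>)"
    if s: "s \<in> {0..1}" for s
  proof -
    have "{\<omega> \<in> space M. X s \<omega> = X t \<omega>} = (\<Union>y. {\<omega> \<in> space M. X s \<omega> = y \<and> X t \<omega> = y})" by auto
    also have "\<dots> \<in> events" using event_eq_eq[OF s t] by (intro sets.finite_UN) auto
    finally have N: "{\<omega> \<in> space M. X s \<omega> \<noteq> X t \<omega>} \<in> events"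
      by (rule sets.sets_Collect_neg)
    \<comment> \<open>Taking \<open>u\<close> and \<open>v\<close> from \<open>{s, t}\<close> yields
      both signs of the absolute value at once.\<close>
    have *: "prob {\<omega> \<in> space M. X u \<omega> = x} \<le>
        prob {\<omega> \<in> space M. X v \<omega> = x} + prob {\<omega> \<in> space M. X s \<omega> \<noteq> X t \<omega>}"
      if "u \<in> {s, t}" "v \<in> {s, t}" for u v
    proof -
      have uv: "u \<in> {0..1}" "v \<in> {0..1}" using that s t by auto
      have "prob {\<omega> \<in> space M. X u \<omega> = x} \<le>
          prob ({\<omega> \<in> space M. X v \<omega> = x} \<union> {\<omega> \<in> space M. X s \<omega> \<noteq> X t \<omega>})"
        using that N event_eq[OF uv(2)] by (intro finite_measure_mono) auto
      also have "\<dots> \<le> prob {\<omega> \<in> space M. X v \<omega> = x} + prob {\<omega> \<in> space M. X s \<omega> \<noteq> X t \<omega>}"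
        using N event_eq[OF uv(2)] by (intro measure_Un_le) auto
      finally show ?thesis .
    qed
    show ?thesis using *[of s t] *[of t s] by (simp add: marginal_def abs_le_iff)
  qed
  show "((\<lambda>s. marginal M X s $ x) \<longlongrightarrow> marginal M X t $ x) (at t within {0..1})"
    using le by (intro Lim_null_comparison[OF _ stochastically_continuous[OF t], THEN LIM_zero_cancel])
      (simp add: eventually_at_filter)
qed

text \<open>By total probability over the state at time \<open>t\<close>, the increment of the
  marginal is a sum of transition probabilities minus Kronecker deltas, weighted by the marginal at
  \<open>t\<close>. Dividing by \<open>h\<close> gives the rates in the limit.\<close>

lemma marginal_right_derivative:
  assumes t: "t \<in> {0..<1}" and pos: "\<And>y. \<P>(\<omega> in M. X t \<omega> = y) > 0"
  shows "((\<lambda>t. marginal M X t $ x) has_real_derivative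
    (\<Sum>y\<in>UNIV. R t x y * marginal M X t $ y)) (at_right t)"
proof -
  let ?q = "\<lambda>t. marginal M X t $ x"
  let ?p = "\<lambda>h y. \<P>(\<omega> in M. X (t + h) \<omega> = x \<bar> X t \<omega> = y)"
  let ?d = "\<lambda>y. if x = y then 1 else 0 :: real"
  have "((\<lambda>h. \<Sum>y\<in>UNIV. (?p h y - ?d y) / h * marginal M X t $ y)
      \<longlongrightarrow> (\<Sum>y\<in>UNIV. R t x y * marginal M X t $ y)) (at_right 0)"
    by (intro tendsto_sum tendsto_mult tendsto_const transition_quotient_tendsto assms)
  moreover have "eventually (\<lambda>h. (\<Sum>y\<in>UNIV. (?p h y - ?d y) / h * marginal M X t $ y) =
      (?q (t + h) - ?q t) / h) (at_right 0)"
  proof (rule eventually_mono[OF eventually_at_right_real[of 0 "1 - t"]])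
    show "0 < 1 - t" using t by simp
    fix h assume h: "h \<in> {0<..<1 - t}"
    have th: "t + h \<in> {0..1}" "t \<in> {0..1}" using t h by auto
    have "?q (t + h) = (\<Sum>y\<in>UNIV. prob {\<omega> \<in> space M. X (t + h) \<omega> = x \<and> X t \<omega> = y})"
      using event_eq_eq[OF th] unfolding marginal_def vec_lambda_beta
      by (subst finite_measure_finite_Union[symmetric])
        (auto simp: disjoint_family_on_def intro!: arg_cong[where f = prob])
    \<comment> \<open>Positivity of the conditioning events lets the denominator of each conditional
      probability cancel against the marginal.\<close>
    also have "\<dots> = (\<Sum>y\<in>UNIV. ?p h y * marginal M X t $ y)"
      using pos by (intro sum.cong) (auto simp: cond_prob_def marginal_def less_imp_neq[THEN not_sym])
    finally have "?q (t + h) = \<dots>" .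
    moreover have "?q t = (\<Sum>y\<in>UNIV. ?d y * marginal M X t $ y)"
      using sum.delta'[of UNIV x "\<lambda>y. marginal M X t $ y"] by (simp add: if_distrib if_distribR cong: if_cong)
    ultimately show "(\<Sum>y\<in>UNIV. (?p h y - ?d y) / h * marginal M X t $ y) = (?q (t + h) - ?q t) / h"
      by (simp add: sum_divide_distrib left_diff_distrib diff_divide_distrib sum_subtractf)
  qed
  ultimately have "((\<lambda>h. (?q (t + h) - ?q t) / h)
      \<longlongrightarrow> (\<Sum>y\<in>UNIV. R t x y * marginal M X t $ y)) (at_right 0)"
    by (rule Lim_transform_eventually)
  then show ?thesis
    unfolding has_field_derivative_iff
    by (subst filterlim_at_right_to_0) (simp add: add.commute)
qed

text \<open>Left derivatives, including the one at \<open>t = 1\<close>, come from right derivatives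
  at earlier times, which is why positivity is assumed at all times and not only at
  \<open>t\<close>.\<close>

lemma master_equation:
  assumes pos: "\<And>t x. t \<in> {0..1} \<Longrightarrow> \<P>(\<omega> in M. X t \<omega> = x) > 0" and t: "t \<in> {0..1}"
  shows "((\<lambda>t. marginal M X t $ x) has_real_derivative
    (\<Sum>y\<in>UNIV. R t x y * marginal M X t $ y)) (at t within {0..1})"
proof (rule continuous_right_derivative_imp_derivative[OF marginal_continuous _ _ t])
  show "continuous_on {0..1} (\<lambda>t. \<Sum>y\<in>UNIV. R t x y * marginal M X t $ y)"
    by (intro continuous_intros rate_continuous marginal_continuous)
qed (use pos marginal_right_derivative in auto)

end

theorem mainTheorem5:
  fixes M :: "'w measure"
    and X :: "real \<Rightarrow> 'w \<Rightarrow> 'k::finite ^ 'd::finite"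
    and R :: "real \<Rightarrow> 'k ^ 'd \<Rightarrow> 'k ^ 'd \<Rightarrow> real"
  assumes "ctmc M X R"
    and "\<And>t x. t \<in> {0..1} \<Longrightarrow> marginal M X t $ x > 0"
  shows "(\<forall>t\<in>{0..<1}. \<forall>\<phi> x.
           adjoint (generator M X t) \<phi> $ x = (\<Sum>y\<in>UNIV. R t x y * \<phi> $ y)) \<and>
         (\<forall>t\<in>{0..1}. \<forall>x.
           ((\<lambda>t. marginal M X t $ x) has_real_derivative
             (\<Sum>y\<in>UNIV. R t x y * marginal M X t $ y)) (at t within {0..1})) \<and>
         (\<forall>s\<in>{0<..1}. \<forall>\<phi> x.
           reverse_generator M X s \<phi> $ x =
             (\<Sum>y\<in>UNIV. R (1 - s) x y * (marginal M X (1 - s) $ y / marginal M X (1 - s) $ x)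
                          * (\<phi> $ y - \<phi> $ x)))"
proof -
  interpret ctmc M X R by fact
  have pos: "\<P>(\<omega> in M. X t \<omega> = x) > 0" if "t \<in> {0..1}" for t x
    using assms(2)[OF that, of x] by (simp add: marginal_def)
  show ?thesis
    using pos by (intro conjI ballI allI master_equation reverse_generator_eq)
      (auto simp: adjoint_generator_eq)
qed

end
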